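(* Let $n\ge 2$ and let $z_1,\dots,z_{n-1}$ be pairwise distinct complex numbers. For $1\le k\le n-1$ put $$\alpha_k=\frac{(-1)^{n+k-1}}{\prod_{k<i\le n-1}(z_i-z_k)\,\prod_{1\le j<k}(z_k-z_j)},\qquad L_k=\alpha_k V_1,\qquad V_1=\mathrm{col}[1,1,\dots,1]\in\mathbb{C}^n .$$ Then the vector function $$Y_1(z)=\sum_{k=1}^{n-1}\frac{L_k}{z-z_k}$$ is a rational solution of the system $$\frac{dY}{dz}=\rho\sum_{k=1}^{n-1}\frac{P_k}{z-z_k}\,Y\qquad\text{with }\rho=-1 .$$
   Context: For $1\le k\le n-1$, $P_k=P(1,k+1)$ denotes the $n\times n$ permutation matrix of the transposition of $1$ and $k+1$ in the natural representation of the symmetric group $S_n$: its $(1,k+1)$ and $(k+1,1)$ entries equal $1$, its $(l,l)$ entries equal $1$ for $l\ne 1,k+1$, and all other entries are $0$. $\mathrm{col}[\cdot]$ denotes a column vector, and empty products equal $1$. *)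

theory Defs
  imports "HOL-Analysis.Analysis" "HOL-Computational_Algebra.Polynomial"
begin

text \<open>
  The space of column vectors of height n is \<open>complex ^ 'n\<close>. An enumeration \<open>e\<close>, a bijection from
  \<open>{1..n}\<close> onto the index type, says which coordinate is the \<open>l\<close>-th one, and forces
  \<open>CARD('n) = n\<close>.
\<close>

text \<open>The matrix of a permutation in the natural representation: it maps the basis vector
  \<open>axis j 1\<close> to \<open>axis (p j) 1\<close>.\<close>

definition perm_matrix :: "('n \<Rightarrow> 'n) \<Rightarrow> complex ^ 'n ^ 'n" where
  "perm_matrix p = (\<chi> i j. if i = p j then 1 else 0)"

definition P_mat :: "(nat \<Rightarrow> 'n) \<Rightarrow> nat \<Rightarrow> complex ^ 'n ^ 'n" where
  "P_mat e k = perm_matrix (Transposition.transpose (e 1) (e (k + 1)))"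

lemma perm_matrix_axis: "perm_matrix p *v axis j 1 = axis (p j) 1"
  by (simp add: vec_eq_iff perm_matrix_def matrix_vector_mult_def axis_def
      mult_delta_right)

lemma P_mat_entries:
  fixes e :: "nat \<Rightarrow> 'n::finite"
  assumes "bij_betw e {1..n} UNIV" "k \<in> {1..n - 1}" "l \<in> {1..n}" "m \<in> {1..n}"
  shows "P_mat e k $ e l $ e m =
    (if (l, m) = (1, k + 1) \<or> (l, m) = (k + 1, 1) \<or> (l = m \<and> l \<noteq> 1 \<and> l \<noteq> k + 1) then 1 else 0)"
proof -
  have eq: "e x = e y \<longleftrightarrow> x = y" if "x \<in> {1..n}" "y \<in> {1..n}" for x y
    using bij_betw_imp_inj_on[OF assms(1)] that by (simp add: inj_on_eq_iff)
  have one: "1 \<in> {1..n}" and suc: "k + 1 \<in> {1..n}" using assms(2) by auto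
  let ?t = "Transposition.transpose 1 (k + 1) m"
  have "Transposition.transpose (e 1) (e (k + 1)) (e m) = e ?t"
    unfolding Transposition.transpose_def eq[OF assms(4) one] eq[OF assms(4) suc]
    by (simp only: if_distrib [of e])
  moreover have "?t \<in> {1..n}"
    using one suc assms(4) by (metis transpose_apply_first transpose_apply_second transpose_apply_other)
  ultimately have "P_mat e k $ e l $ e m = (if l = ?t then 1 else 0)"
    using eq[OF assms(3)] by (simp only: P_mat_def perm_matrix_def vec_lambda_beta)
  also have "l = ?t \<longleftrightarrow> (l, m) = (1, k + 1) \<or> (l, m) = (k + 1, 1) \<or> (l = m \<and> l \<noteq> 1 \<and> l \<noteq> k + 1)"
    unfolding Transposition.transpose_def prod.inject
    by (cases "m = 1"; cases "m = k + 1"; cases "l = m") simp_all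
  finally show ?thesis .
qed

text \<open>The coefficient matrix \<open>\<rho> \<Sum>\<^sub>k P\<^sub>k / (z - z\<^sub>k)\<close> of the system, written entrywise.\<close>

definition system_matrix ::
    "(nat \<Rightarrow> 'n) \<Rightarrow> nat \<Rightarrow> (nat \<Rightarrow> complex) \<Rightarrow> complex \<Rightarrow> complex \<Rightarrow> complex ^ 'n ^ 'n" where
  "system_matrix e n zs \<rho> z = (\<chi> i j. \<rho> * (\<Sum>k=1..n-1. P_mat e k $ i $ j / (z - zs k)))"

text \<open>\<open>Y\<close> satisfies \<open>dY/dz = A(z) Y\<close> at every point of \<open>S\<close>. The derivative is the complex one:
  the Frechet derivative is required to be multiplication of a fixed vector by the complex
  increment.\<close>

definition solves_linear_system ::
    "(complex \<Rightarrow> complex ^ 'n ^ 'n) \<Rightarrow> complex set \<Rightarrow> (complex \<Rightarrow> complex ^ 'n::finite) \<Rightarrow> bool" where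
  "solves_linear_system A S Y \<longleftrightarrow>
     (\<forall>z\<in>S. (Y has_derivative (\<lambda>h. h *s (A z *v Y z))) (at z))"

text \<open>Every component is a quotient of polynomials whose denominator has no zero in \<open>S\<close>.\<close>

definition rational_vector_on :: "complex set \<Rightarrow> (complex \<Rightarrow> complex ^ 'n) \<Rightarrow> bool" where
  "rational_vector_on S Y \<longleftrightarrow>
     (\<forall>i. \<exists>p q :: complex poly. \<forall>z\<in>S. poly q z \<noteq> 0 \<and> Y z $ i = poly p z / poly q z)"

definition alpha :: "nat \<Rightarrow> (nat \<Rightarrow> complex) \<Rightarrow> nat \<Rightarrow> complex" where
  "alpha n zs k = (-1) ^ (n + k - 1) /
     ((\<Prod>i\<in>{k<..n-1}. zs i - zs k) * (\<Prod>j\<in>{1..<k}. zs k - zs j))"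

definition V1 :: "complex ^ 'n" where
  "V1 = (\<chi> i. 1)"

definition L_vec :: "nat \<Rightarrow> (nat \<Rightarrow> complex) \<Rightarrow> nat \<Rightarrow> complex ^ 'n" where
  "L_vec n zs k = alpha n zs k *s V1"

text \<open>Only the values off the poles \<open>zs k\<close> are meaningful, as \<open>1 / 0 = 0\<close>.\<close>

definition Y1 :: "nat \<Rightarrow> (nat \<Rightarrow> complex) \<Rightarrow> complex \<Rightarrow> complex ^ 'n" where
  "Y1 n zs z = (\<Sum>k=1..n-1. (1 / (z - zs k)) *s L_vec n zs k)"

end

theory Submission
  imports Defs
begin

text \<open>
  Moving the sign into the products gives \<open>\<alpha>\<^sub>k = \<Prod>\<^sub>i\<^sub>\<noteq>\<^sub>k 1 / (z\<^sub>k - z\<^sub>i)\<close>. These are the residues of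
  \<open>f(z) = \<Prod>\<^sub>k 1 / (z - z\<^sub>k)\<close>, so \<open>Y\<^sub>1 = f V\<^sub>1\<close> by partial fractions. Each \<open>P\<^sub>k\<close> fixes \<open>V\<^sub>1\<close>, so the
  system reduces to the scalar equation \<open>f' = - f \<Sum>\<^sub>k 1 / (z - z\<^sub>k)\<close>, the logarithmic derivative of \<open>f\<close>.
\<close>

text \<open>The merging identity for the induction in \<open>partial_fractions_distinct\<close>:
  \<open>b\<close> is the new pole, \<open>c\<close> an old one, and \<open>y\<close> carries the
  old coefficient.\<close>

lemma partial_fractions_two:
  fixes b c x y :: "'a::field"
  assumes "b \<noteq> c" "x \<noteq> b" "x \<noteq> c"
  shows "y / (b - c) / (x - b) + y / (c - b) / (x - c) = y / (x - c) / (x - b)"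
proof -
  \<comment> \<open>This is what remains after clearing all four denominators and factoring out
    \<open>y\<close>.\<close>
  have "(c - b) * (x - c) + (b - c) * (x - b) = (b - c) * (c - b)"
    by algebra
  then show ?thesis
    using assms by (simp add: divide_simps flip: distrib_left)
qed

text \<open>Induction on the set of poles. A new pole \<open>f a\<close> divides each old
  coefficient by \<open>f k - f a\<close>, and its own coefficient is the old formula evaluated at
  \<open>f a\<close>; hence \<open>x\<close> is arbitrary in the induction. For empty
  \<open>A\<close> the sum would be 0 but the right side 1.\<close>

lemma partial_fractions_distinct:
  fixes f :: "'a \<Rightarrow> 'b::field"
  assumes "finite A" "A \<noteq> {}" "inj_on f A" "x \<notin> f ` A"
  shows "(\<Sum>k\<in>A. 1 / (\<Prod>i\<in>A - {k}. f k - f i) / (x - f k)) = 1 / (\<Prod>k\<in>A. x - f k)"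
  using assms
proof (induction A arbitrary: x rule: finite_ne_induct)
  case (singleton a)
  then show ?case by simp
next
  case (insert a A)
  let ?c = "\<lambda>k. 1 / (\<Prod>i\<in>A - {k}. f k - f i)"
  have inj: "inj_on f A" and a: "f a \<notin> f ` A" and x: "x \<notin> f ` A" "x \<noteq> f a"
    using insert.hyps insert.prems by auto
  have c: "1 / (\<Prod>i\<in>insert a A - {k}. f k - f i) = ?c k / (f k - f a)" if "k \<in> A" for k
  proof -
    have "insert a A - {k} = insert a (A - {k})" "a \<notin> A - {k}"
      using that insert.hyps by auto
    then show ?thesis
      using insert.hyps by simp
  qed
  have "(\<Sum>k\<in>insert a A. 1 / (\<Prod>i\<in>insert a A - {k}. f k - f i) / (x - f k))
      = 1 / (\<Prod>i\<in>A. f a - f i) / (x - f a) + (\<Sum>k\<in>A. ?c k / (f k - f a) / (x - f k))"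
    using insert.hyps c by simp
  also have "\<dots> = (\<Sum>k\<in>A. ?c k / (f a - f k)) / (x - f a) + (\<Sum>k\<in>A. ?c k / (f k - f a) / (x - f k))"
    \<comment> \<open>The hypothesis at \<open>x = f a\<close>, read from right to left, spreads the
      new coefficient over the old poles.\<close>
    by (simp only: insert.IH[OF inj a])
  also have "\<dots> = (\<Sum>k\<in>A. ?c k / (f a - f k) / (x - f a) + ?c k / (f k - f a) / (x - f k))"
    by (simp add: sum.distrib sum_divide_distrib)
  also have "\<dots> = (\<Sum>k\<in>A. ?c k / (x - f k) / (x - f a))"
  proof (rule sum.cong[OF refl])
    fix k assume "k \<in> A"
    then have "f a \<noteq> f k"
      using a by auto
    then show "?c k / (f a - f k) / (x - f a) + ?c k / (f k - f a) / (x - f k)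
        = ?c k / (x - f k) / (x - f a)"
      using \<open>k \<in> A\<close> x by (intro partial_fractions_two) auto
  qed
  also have "\<dots> = 1 / (\<Prod>k\<in>insert a A. x - f k)"
    unfolding sum_divide_distrib[symmetric] insert.IH[OF inj x(1)]
    using insert.hyps by simp
  finally show ?case .
qed

lemma has_field_derivative_inverse_prod_linear:
  fixes f :: "'a \<Rightarrow> 'b::real_normed_field"
  assumes "finite A" "x \<notin> f ` A"
  shows "((\<lambda>x. 1 / (\<Prod>k\<in>A. x - f k)) has_field_derivative
           - (1 / (\<Prod>k\<in>A. x - f k)) * (\<Sum>k\<in>A. 1 / (x - f k))) (at x)"
  using assms
proof (induction A rule: finite_induct)
  case empty
  then show ?case by simp
next
  case (insert a A)
  have "((\<lambda>x. 1 / (x - f a)) has_field_derivative - (1 / (x - f a)\<^sup>2)) (at x)"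
    using insert.prems by (auto intro!: derivative_eq_intros simp: power2_eq_square)
  then have "((\<lambda>x. 1 / (x - f a) * (1 / (\<Prod>k\<in>A. x - f k))) has_field_derivative
      - (1 / (\<Prod>k\<in>insert a A. x - f k)) * (\<Sum>k\<in>insert a A. 1 / (x - f k))) (at x)"
    by (rule DERIV_cong[OF DERIV_mult[OF _ insert.IH]])
      (use insert in \<open>simp_all add: power2_eq_square add_divide_distrib mult_ac\<close>)
  then show ?case
    using insert.hyps by simp
qed

lemma alpha_eq:
  assumes "k \<in> {1..n - 1}"
  shows "alpha n zs k = 1 / (\<Prod>i\<in>{1..n - 1} - {k}. zs k - zs i)"
proof -
  have "(\<Prod>i\<in>{k<..n - 1}. zs i - zs k) = (\<Prod>i\<in>{k<..n - 1}. - 1 * (zs k - zs i))"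
    by simp
  also have "\<dots> = (- 1) ^ (n - 1 - k) * (\<Prod>i\<in>{k<..n - 1}. zs k - zs i)"
    by (simp only: prod.distrib prod_constant card_greaterThanAtMost)
  finally have neg: "(\<Prod>i\<in>{k<..n - 1}. zs i - zs k)
      = (- 1) ^ (n - 1 - k) * (\<Prod>i\<in>{k<..n - 1}. zs k - zs i)" .
  have "{1..n - 1} - {k} = {k<..n - 1} \<union> {1..<k}"
    using assms by auto
  then have split: "(\<Prod>i\<in>{1..n - 1} - {k}. zs k - zs i)
      = (\<Prod>i\<in>{k<..n - 1}. zs k - zs i) * (\<Prod>j\<in>{1..<k}. zs k - zs j)"
    by (simp add: prod.union_disjoint disjoint_iff)
  \<comment> \<open>The exponent in \<open>alpha\<close> and the number of reversed differences have
    the same parity; \<open>k \<le> n - 1\<close> keeps the subtraction exact.\<close>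
  have "n + k - 1 = (n - 1 - k) + 2 * k"
    using assms by auto
  then have "(- 1 :: complex) ^ (n + k - 1) = (- 1) ^ (n - 1 - k)"
    by (simp only: power_add power_mult) simp
  then show ?thesis
    unfolding alpha_def neg split by simp
qed

lemma Y1_eq:
  assumes "n \<ge> 2" "inj_on zs {1..n - 1}" "z \<notin> zs ` {1..n - 1}"
  shows "(Y1 n zs z :: complex ^ 'n) = (1 / (\<Prod>k=1..n - 1. z - zs k)) *s V1"
proof -
  have "(Y1 n zs z :: complex ^ 'n) = (\<Sum>k=1..n - 1. alpha n zs k / (z - zs k)) *s V1"
    by (simp add: Y1_def L_vec_def vec.scale_sum_left)
  also have "(\<Sum>k=1..n - 1. alpha n zs k / (z - zs k)) = 1 / (\<Prod>k=1..n - 1. z - zs k)"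
    \<comment> \<open>\<open>n \<ge> 2\<close> makes the set of poles nonempty.\<close>
    using partial_fractions_distinct[of "{1..n - 1}" zs z] assms by (simp add: alpha_eq)
  finally show ?thesis .
qed

text \<open>Multiplying by \<open>V1\<close> takes row sums, and each row has exactly one entry 1
  because \<open>p\<close> is bijective.\<close>

lemma perm_matrix_V1:
  fixes p :: "'n::finite \<Rightarrow> 'n"
  assumes "bij p"
  shows "perm_matrix p *v V1 = V1"
proof -
  have "(\<Sum>j\<in>UNIV. if i = p j then 1 else 0 :: complex) = 1" for i
    using sum.reindex_bij_betw[of p UNIV UNIV "\<lambda>j. if i = j then 1 else 0 :: complex"] assms
    by simp
  then show ?thesis
    by (simp add: perm_matrix_def V1_def matrix_vector_mult_def vec_eq_iff)
qed

lemma system_matrix_V1: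
  fixes e :: "nat \<Rightarrow> 'n::finite"
  shows "system_matrix e n zs \<rho> z *v V1 = (\<rho> * (\<Sum>k=1..n - 1. 1 / (z - zs k))) *s V1"
proof -
  have row: "(\<Sum>j\<in>UNIV. P_mat e k $ i $ j) = 1" for k i
    using perm_matrix_V1[of "Transposition.transpose (e 1) (e (k + 1))"]
    by (simp add: P_mat_def V1_def matrix_vector_mult_def vec_eq_iff)
  have "(\<Sum>j\<in>UNIV. \<rho> * (\<Sum>k=1..n - 1. P_mat e k $ i $ j / (z - zs k)))
      = \<rho> * (\<Sum>k=1..n - 1. 1 / (z - zs k))" for i
    \<comment> \<open>Summing over the columns first turns each numerator into a row sum, which is
      1.\<close>
    by (subst sum_distrib_left[symmetric], subst sum.swap)
      (simp add: row flip: sum_divide_distrib)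
  then show ?thesis
    by (simp add: system_matrix_def V1_def matrix_vector_mult_def vec_eq_iff)
qed

theorem proposition2p2:
  fixes n :: nat
    and e :: "nat \<Rightarrow> 'n::finite"
    and zs :: "nat \<Rightarrow> complex"
  assumes "n \<ge> 2"
    and "bij_betw e {1..n} (UNIV :: 'n set)"
    and "inj_on zs {1..n-1}"
  shows "rational_vector_on (- (zs ` {1..n-1})) (Y1 n zs :: complex \<Rightarrow> complex ^ 'n)
    \<and> solves_linear_system (system_matrix e n zs (-1)) (- (zs ` {1..n-1}))
        (Y1 n zs :: complex \<Rightarrow> complex ^ 'n)"
proof
  let ?S = "- (zs ` {1..n - 1})"
  let ?f = "\<lambda>z. 1 / (\<Prod>k=1..n - 1. z - zs k)"
  have Y: "(Y1 n zs z :: complex ^ 'n) = ?f z *s V1" if "z \<in> ?S" for z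
    using that assms by (intro Y1_eq) auto
  show "rational_vector_on ?S (Y1 n zs :: complex \<Rightarrow> complex ^ 'n)"
    unfolding rational_vector_on_def
  proof (intro allI exI ballI conjI)
    fix i :: 'n and z assume z: "z \<in> ?S"
    \<comment> \<open>The witnesses \<open>p\<close> and \<open>q\<close> are still schematic; the
      two goals fix them as 1 and the monic polynomial with roots \<open>zs k\<close>.\<close>
    show "poly (\<Prod>k=1..n - 1. [:- zs k, 1:]) z \<noteq> 0"
      using z by (auto simp: poly_prod)
    show "Y1 n zs z $ i = poly 1 z / poly (\<Prod>k=1..n - 1. [:- zs k, 1:]) z"
      by (simp add: Y[OF z] V1_def poly_prod)
  qed
  show "solves_linear_system (system_matrix e n zs (-1)) ?S (Y1 n zs :: complex \<Rightarrow> complex ^ 'n)"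
    unfolding solves_linear_system_def
  proof
    fix z assume z: "z \<in> ?S"
    let ?s = "\<Sum>k=1..n - 1. 1 / (z - zs k)"
    \<comment> \<open>Linear over the reals, hence bounded in finite dimension; this map carries the
      scalar derivative of \<open>?f\<close> over to vectors.\<close>
    have "linear (\<lambda>c. c *s V1 :: complex ^ 'n)"
      by (intro linearI) (simp_all add: vec_eq_iff V1_def)
    then have lin: "bounded_linear (\<lambda>c. c *s V1 :: complex ^ 'n)"
      by (simp add: linear_conv_bounded_linear)
    have "(?f has_field_derivative - ?f z * ?s) (at z)"
      using z by (intro has_field_derivative_inverse_prod_linear) auto
    then have "((\<lambda>w. ?f w *s V1 :: complex ^ 'n) has_derivative (\<lambda>h. (- ?f z * ?s * h) *s V1)) (at z)"
      unfolding has_field_derivative_def by (rule bounded_linear.has_derivative[OF lin])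
    also have "(\<lambda>h. (- ?f z * ?s * h) *s V1 :: complex ^ 'n)
        = (\<lambda>h. h *s (system_matrix e n zs (-1) z *v Y1 n zs z))"
      by (simp add: Y[OF z] vector_scalar_commute system_matrix_V1 mult_ac)
    \<comment> \<open>The closed form of \<open>Y1\<close> is known only off the poles; as they are
      finitely many, \<open>?S\<close> is an open neighbourhood of \<open>z\<close>, which suffices
      for the derivative.\<close>
    finally show "(Y1 n zs has_derivative (\<lambda>h. h *s (system_matrix e n zs (-1) z *v Y1 n zs z))) (at z)"
      by (rule has_derivative_transform_within_open[where s = ?S])
        (use z Y in \<open>auto intro!: open_Compl finite_imp_closed\<close>)
  qed
qed

end
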